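(* Let $n \geqslant 0$ and let $\mathcal{R} \leqslant \mathcal{R}'$ be transfer systems on $[n]$. Then $\mathcal{R} \preccurlyeq \mathcal{R}'$ if and only if $\pi_{\mathcal{R}} \leqslant \pi_{\mathcal{R}'}$ in the Kreweras ordering, i.e. if and only if for all $i,j \in [n]$, $\pi_{\mathcal{R}}(i) = \pi_{\mathcal{R}}(j)$ implies $\pi_{\mathcal{R}'}(i)=\pi_{\mathcal{R}'}(j)$. That is, under the bijection sending a transfer system $\mathcal{R}$ on $[n]$ to the noncrossing partition of $[n]$ whose blocks are the nonempty fibers of $\pi_{\mathcal{R}}$, the ordering $\preccurlyeq$ is exactly the Kreweras ordering.
   Context: $[n]$ is the total order $\{0<1<\cdots<n\}$, viewed as a lattice and as a category with one morphism $x \to y$ when $x\leqslant y$. A transfer system on $[n]$ is a partial order $\mathcal{R}$ on $\{0,\dots,n\}$ such that $x \,\mathcal{R}\, y$ implies $x \leqslant y$, and if $x\,\mathcal{R}\,y$ and $z \leqslant y$ then $\min(x,z)\,\mathcal{R}\,z$. Write $\mathcal{R}\leqslant\mathcal{R}'$ if $x\,\mathcal{R}\,y$ implies $x\,\mathcal{R}'\,y$. The left class of $\mathcal{R}'$, denoted $\mathcal{L}'$, is given by: $x\,\mathcal{L}'\,y$ iff $x\leqslant y$ and for all $a\,\mathcal{R}'\,b$ with $x\leqslant a$ and $y \leqslant b$ one has $y\leqslant a$. $\mathcal{R}\circ\mathcal{L}'$ is the set of morphisms $x\to y$ such that $x\,\mathcal{L}'\,z\,\mathcal{R}\,y$ for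 some $z$. Define $\mathcal{R}\preccurlyeq\mathcal{R}'$ to mean that $\mathcal{R}\leqslant\mathcal{R}'$ and $\mathcal{R}\circ\mathcal{L}'$ is closed under composition; in that case $(\mathcal{R},\mathcal{R}')$ is called a composition closed premodel structure. For a transfer system $\mathcal{R}$ on $[n]$, $\pi_{\mathcal{R}}\colon[n]\to[n]$ sends $i$ to the maximal $j$ with $i\,\mathcal{R}\,j$; the nonempty fibers of $\pi_{\mathcal{R}}$ form a noncrossing partition of $\{0,\dots,n\}$, and this gives a bijection (known from earlier work) between transfer systems on $[n]$ and noncrossing partitions of $\{0,\dots,n\}$. A partition is noncrossing if whenever $a<b<c<d$ with $a,c$ in one block and $b,d$ in one block, all four lie in the same block. The Kreweras ordering on noncrossing partitions is the refinement order (finer partitions are smaller). *)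

theory Defs
  imports Main "HOL-Library.Disjoint_Sets"
begin

text \<open>
  A set of morphisms of the poset category [n] is encoded as a relation on the natural numbers
  contained in \<open>{0..n} \<times> {0..n}\<close>, the pair \<open>(x, y)\<close> being the morphism from \<open>x\<close> to \<open>y\<close>. The
  order on transfer systems is then inclusion of relations.
\<close>

definition transfer_system :: "nat \<Rightarrow> nat rel \<Rightarrow> bool" where
  "transfer_system n R \<longleftrightarrow>
     partial_order_on {0..n} R \<and>
     (\<forall>x y. (x, y) \<in> R \<longrightarrow> x \<le> y) \<and>
     (\<forall>x y z. (x, y) \<in> R \<and> z \<le> y \<longrightarrow> (min x z, z) \<in> R)"

definition left_class :: "nat \<Rightarrow> nat rel \<Rightarrow> nat rel" where
  "left_class n R =
     {(x, y). x \<in> {0..n} \<and> y \<in> {0..n} \<and> x \<le> y \<and>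
              (\<forall>a b. (a, b) \<in> R \<and> x \<le> a \<and> y \<le> b \<longrightarrow> y \<le> a)}"

text \<open>
  The composite class of R with the left class L' of R' consists of an L'-morphism followed by an
  R-morphism. Since \<open>(O)\<close> lists relations in diagrammatic order, it is written with L' first.
  Closure of a set of morphisms under composition is transitivity.
\<close>

definition composition_closed_premodel :: "nat \<Rightarrow> nat rel \<Rightarrow> nat rel \<Rightarrow> bool" where
  "composition_closed_premodel n R R' \<longleftrightarrow> R \<subseteq> R' \<and> trans (left_class n R' O R)"

definition pi_map :: "nat rel \<Rightarrow> nat \<Rightarrow> nat" where
  "pi_map R i = Max {j. (i, j) \<in> R}"

definition fiber_partition :: "nat \<Rightarrow> nat rel \<Rightarrow> nat set set" where
  "fiber_partition n R = (\<lambda>j. {i \<in> {0..n}. pi_map R i = j}) ` {0..n} - {{}}"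

definition noncrossing_partition :: "nat \<Rightarrow> nat set set \<Rightarrow> bool" where
  "noncrossing_partition n P \<longleftrightarrow>
     partition_on {0..n} P \<and>
     (\<forall>a b c d. a < b \<and> b < c \<and> c < d \<and> (\<exists>X\<in>P. {a, c} \<subseteq> X) \<and> (\<exists>Y\<in>P. {b, d} \<subseteq> Y)
        \<longrightarrow> (\<exists>Z\<in>P. {a, b, c, d} \<subseteq> Z))"

definition kreweras_le :: "nat \<Rightarrow> nat set set \<Rightarrow> nat set set \<Rightarrow> bool" where
  "kreweras_le n P Q \<longleftrightarrow>
     noncrossing_partition n P \<and> noncrossing_partition n Q \<and> refines {0..n} P Q"

end

theory Submission
  imports Defs
begin

text \<open>
  A transfer system is the same thing as its map \<open>\<pi>\<close>: one has \<open>x R y\<close> iff \<open>x \<le> y \<le> \<pi> x\<close>, and the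
  maps that occur are those with \<open>x \<le> \<pi> x\<close> and \<open>\<pi> y \<le> \<pi> x\<close> whenever \<open>x \<le> y \<le> \<pi> x\<close>. In particular
  \<open>\<pi>\<close> is idempotent and sends every element to the maximum of its fiber. The left class also becomes
  explicit: \<open>x L' y\<close> iff \<open>\<pi>' a < y\<close> for all \<open>a\<close> with \<open>x \<le> a < y\<close>. If \<open>R \<circ> L'\<close> is closed under
  composition and \<open>\<pi>' (\<pi> i) < \<pi>' i\<close>, then composing \<open>i \<rightarrow> \<pi> i\<close> with the left morphism from \<open>\<pi> i\<close> to
  the successor of \<open>\<pi>' (\<pi> i)\<close> gives a contradiction; so \<open>\<pi>' \<circ> \<pi> = \<pi>'\<close>. Conversely this identity
  allows one to factor any composite of two elements of \<open>R \<circ> L'\<close> through one of the two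
  intermediate objects.
\<close>

section \<open>Transfer systems and their maximum maps\<close>

lemma transfer_systemD:
  assumes "transfer_system n R"
  shows "R \<subseteq> {0..n} \<times> {0..n}"
    and "x \<le> n \<Longrightarrow> (x, x) \<in> R"
    and "(x, y) \<in> R \<Longrightarrow> (y, z) \<in> R \<Longrightarrow> (x, z) \<in> R"
    and "(x, y) \<in> R \<Longrightarrow> x \<le> y"
    and "(x, y) \<in> R \<Longrightarrow> z \<le> y \<Longrightarrow> (min x z, z) \<in> R"
  using assms
  unfolding transfer_system_def partial_order_on_def preorder_on_def
  by (auto dest: refl_onD transD)

lemma pi_map_mem:
  assumes "transfer_system n R" "x \<le> n"
  shows "(x, pi_map R x) \<in> R"
proof -
  have "finite {j. (x, j) \<in> R}"
    by (rule finite_subset[of _ "{0..n}"]) (use transfer_systemD(1)[OF assms(1)] in auto)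
  moreover have "x \<in> {j. (x, j) \<in> R}"
    using transfer_systemD(2)[OF assms] by simp
  ultimately show ?thesis
    using Max_in[of "{j. (x, j) \<in> R}"] unfolding pi_map_def by blast
qed

text \<open>Restricting the relation from \<open>x\<close> to \<open>pi_map R x\<close> along
  \<open>y <= pi_map R x\<close> gives one from \<open>min x y = x\<close> to \<open>y\<close>, so
  every intermediate target occurs.\<close>

lemma transfer_system_iff_pi_map:
  assumes "transfer_system n R"
  shows "(x, y) \<in> R \<longleftrightarrow> x \<le> n \<and> x \<le> y \<and> y \<le> pi_map R x"
proof
  assume xy: "(x, y) \<in> R"
  have "finite {j. (x, j) \<in> R}"
    by (rule finite_subset[of _ "{0..n}"]) (use transfer_systemD(1)[OF assms] in auto)
  then have "y \<le> pi_map R x"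
    using xy unfolding pi_map_def by (simp add: Max_ge)
  then show "x \<le> n \<and> x \<le> y \<and> y \<le> pi_map R x"
    using transfer_systemD(1,4)[OF assms] xy by auto
next
  assume "x \<le> n \<and> x \<le> y \<and> y \<le> pi_map R x"
  then show "(x, y) \<in> R"
    using transfer_systemD(5)[OF assms pi_map_mem[OF assms], of x y] by (simp add: min_absorb1)
qed

lemma pi_map_bounds:
  assumes "transfer_system n R" "x \<le> n"
  shows "x \<le> pi_map R x" "pi_map R x \<le> n"
  using pi_map_mem[OF assms] transfer_systemD(1,4)[OF assms(1)] by auto

text \<open>Transitivity in terms of \<pi>: the intervals from \<open>x\<close> to
  \<open>pi_map R x\<close> are pairwise nested or disjoint.\<close>

lemma pi_map_antimono:
  assumes "transfer_system n R" "x \<le> n" "x \<le> y" "y \<le> pi_map R x"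
  shows "pi_map R y \<le> pi_map R x"
proof -
  have "y \<le> n" using assms(4) pi_map_bounds[OF assms(1,2)] by simp
  then have "(x, pi_map R y) \<in> R"
    using transfer_systemD(3)[OF assms(1)] pi_map_mem[OF assms(1)]
      transfer_system_iff_pi_map[OF assms(1)] assms(2-4) by blast
  then show ?thesis using transfer_system_iff_pi_map[OF assms(1)] by blast
qed

lemma pi_map_idem:
  assumes "transfer_system n R" "x \<le> n"
  shows "pi_map R (pi_map R x) = pi_map R x"
  using pi_map_antimono[OF assms, of "pi_map R x"] pi_map_bounds[OF assms]
    pi_map_bounds(1)[OF assms(1), of "pi_map R x"] by (simp add: le_antisym)

text \<open>The lifting condition need only be tested against the longest morphism out of each
  \<open>a\<close>, the one ending at \<open>pi_map R a\<close>.\<close>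

lemma left_class_iff_pi_map:
  assumes "transfer_system n R"
  shows "(x, y) \<in> left_class n R \<longleftrightarrow>
    x \<le> y \<and> y \<le> n \<and> (\<forall>a. x \<le> a \<and> a < y \<longrightarrow> pi_map R a < y)"
proof -
  have "(\<forall>a b. (a, b) \<in> R \<and> x \<le> a \<and> y \<le> b \<longrightarrow> y \<le> a) \<longleftrightarrow>
      (\<forall>a. x \<le> a \<and> a < y \<longrightarrow> pi_map R a < y)" (is "?L \<longleftrightarrow> ?R") if "y \<le> n"
  proof
    assume L: ?L
    show ?R
    proof (intro allI impI)
      fix a assume a: "x \<le> a \<and> a < y"
      then have "(a, pi_map R a) \<in> R" using pi_map_mem[OF assms] that by simp
      then show "pi_map R a < y" using L a by (meson not_le)
    qed
  next
    assume ?R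
    then show ?L
      unfolding transfer_system_iff_pi_map[OF assms] by (meson le_less_trans not_le)
  qed
  then show ?thesis unfolding left_class_def by auto
qed

lemma left_class_comp_iff_pi_map:
  assumes "transfer_system n R" "transfer_system n R'"
  shows "(x, y) \<in> left_class n R' O R \<longleftrightarrow>
    (\<exists>z. x \<le> z \<and> z \<le> n \<and> z \<le> y \<and> y \<le> pi_map R z \<and>
         (\<forall>a. x \<le> a \<and> a < z \<longrightarrow> pi_map R' a < z))"
  unfolding relcomp_unfold transfer_system_iff_pi_map[OF assms(1)]
    left_class_iff_pi_map[OF assms(2)] by auto

section \<open>Closure under composition\<close>

lemma pi_map_absorb_if_trans:
  assumes R: "transfer_system n R" and R': "transfer_system n R'" and "R \<subseteq> R'"
    and tr: "trans (left_class n R' O R)" and i: "i \<le> n"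
  shows "pi_map R' (pi_map R i) = pi_map R' i"
proof (rule ccontr)
  define p q where "p = pi_map R i" and "q = pi_map R' p"
  have ip: "i \<le> p" and pn: "p \<le> n"
    using pi_map_bounds[OF R i] by (auto simp: p_def)
  have "(i, p) \<in> R'" using pi_map_mem[OF R i] \<open>R \<subseteq> R'\<close> by (auto simp: p_def)
  then have "p \<le> pi_map R' i" using transfer_system_iff_pi_map[OF R'] by blast
  then have "q \<le> pi_map R' i" unfolding q_def using pi_map_antimono[OF R' i ip] by blast
  moreover assume "pi_map R' (pi_map R i) \<noteq> pi_map R' i"
  ultimately have less: "q < pi_map R' i" by (simp add: p_def q_def)
  have pq: "p \<le> q" using pi_map_bounds[OF R' pn] by (simp add: q_def)
  have qn: "Suc q \<le> n" using less pi_map_bounds[OF R' i] by simp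
  have "(i, p) \<in> left_class n R' O R"
    unfolding left_class_comp_iff_pi_map[OF R R']
    using i ip by (intro exI[of _ i]) (auto simp: p_def)
  \<comment> \<open>The second factor is the identity of \<open>Suc q\<close>. The first is a left
    morphism because every \<open>a\<close> from \<open>p\<close> to \<open>q = pi_map R' p\<close>
    has \<open>pi_map R' a <= q\<close>.\<close>
  moreover have "(p, Suc q) \<in> left_class n R' O R"
    unfolding left_class_comp_iff_pi_map[OF R R']
    using pq qn pi_map_bounds(1)[OF R qn] pi_map_antimono[OF R' pn]
    by (intro exI[of _ "Suc q"]) (auto simp: q_def less_Suc_eq_le)
  ultimately have "(i, Suc q) \<in> left_class n R' O R" using tr by (rule transD[rotated])
  then obtain z where z: "i \<le> z" "z \<le> Suc q" "Suc q \<le> pi_map R z"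
      "\<And>a. i \<le> a \<Longrightarrow> a < z \<Longrightarrow> pi_map R' a < z"
    unfolding left_class_comp_iff_pi_map[OF R R'] by blast
  \<comment> \<open>If \<open>i < z\<close>, the left condition at \<open>a = i\<close> gives
    \<open>pi_map R' i < z <= Suc q\<close>, against \<open>less\<close>. With \<open>z = i\<close>
    one gets \<open>Suc q <= p <= q\<close>.\<close>
  have "z = i" using z(4)[of i] z(1,2) less by (meson Suc_leI le_less not_less le_trans)
  then show False using z(3) pq by (simp add: p_def)
qed

lemma trans_if_pi_map_absorb:
  assumes R: "transfer_system n R" and R': "transfer_system n R'"
    and absorb: "\<And>i. i \<le> n \<Longrightarrow> pi_map R' (pi_map R i) = pi_map R' i"
  shows "trans (left_class n R' O R)"
proof (rule transI)
  fix x y w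
  assume "(x, y) \<in> left_class n R' O R" "(y, w) \<in> left_class n R' O R"
  then obtain z u where z: "x \<le> z" "z \<le> n" "z \<le> y" "y \<le> pi_map R z"
      "\<And>a. x \<le> a \<Longrightarrow> a < z \<Longrightarrow> pi_map R' a < z"
    and u: "y \<le> u" "u \<le> n" "u \<le> w" "w \<le> pi_map R u"
      "\<And>a. y \<le> a \<Longrightarrow> a < u \<Longrightarrow> pi_map R' a < u"
    unfolding left_class_comp_iff_pi_map[OF R R'] by blast
  show "(x, w) \<in> left_class n R' O R"
  \<comment> \<open>The composite factors through \<open>z\<close> if the interval of
    \<open>z\<close> reaches \<open>w\<close>, and through \<open>u\<close> otherwise.\<close>
  proof (cases "w \<le> pi_map R z")
    case True
    then show ?thesis
      unfolding left_class_comp_iff_pi_map[OF R R'] using z u by (intro exI[of _ z]) auto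
  next
    case False
    have zu: "pi_map R z < u"
    proof (rule ccontr)
      assume "\<not> pi_map R z < u"
      then have "pi_map R u \<le> pi_map R z"
        using pi_map_antimono[OF R z(2), of u] z(3) u(1) by simp
      then show False using False u(4) by simp
    qed
    have "pi_map R' a < u" if a: "x \<le> a" "a < u" for a
    proof -
      consider "a < z" | "z \<le> a" "a < y" | "y \<le> a" by linarith
      then show ?thesis
      proof cases
        case 1
        then show ?thesis using z(3) u(1) z(5)[OF a(1)] by simp
      next
        case 2
        \<comment> \<open>Neither left condition covers this \<open>a\<close>. The second one does
          apply to \<open>pi_map R z\<close>, which lies between \<open>y\<close> and
          \<open>u\<close>; by absorption its \<pi>'-value is that of \<open>z\<close>, which bounds
          that of \<open>a\<close>.\<close>
        have pz: "pi_map R' (pi_map R z) = pi_map R' z" using absorb z(2) by simp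
        have "pi_map R z \<le> pi_map R' z"
          using pi_map_bounds[OF R z(2)] pi_map_bounds(1)[OF R', of "pi_map R z"] pz by simp
        then have "pi_map R' a \<le> pi_map R' z"
          using pi_map_antimono[OF R' z(2), of a] 2 z(4) by simp
        also have "\<dots> < u" using u(5)[OF z(4) zu] pz by simp
        finally show ?thesis .
      next
        case 3
        then show ?thesis using u(5) a by simp
      qed
    qed
    then show ?thesis
      unfolding left_class_comp_iff_pi_map[OF R R'] using z u by (intro exI[of _ u]) auto
  qed
qed

lemma composition_closed_premodel_iff_pi_map:
  assumes R: "transfer_system n R" and R': "transfer_system n R'"
  shows "composition_closed_premodel n R R' \<longleftrightarrow>
    (\<forall>i\<in>{0..n}. \<forall>j\<in>{0..n}. pi_map R i = pi_map R j \<longrightarrow> pi_map R' i = pi_map R' j)"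
    (is "?C \<longleftrightarrow> ?K")
proof
  assume ?C
  then have absorb: "pi_map R' (pi_map R i) = pi_map R' i" if "i \<le> n" for i
    using pi_map_absorb_if_trans[OF R R' _ _ that] unfolding composition_closed_premodel_def by blast
  show ?K
  proof (intro ballI impI)
    fix i j assume "i \<in> {0..n}" "j \<in> {0..n}" "pi_map R i = pi_map R j"
    then show "pi_map R' i = pi_map R' j"
      using absorb[of i] absorb[of j] by simp
  qed
next
  assume K: ?K
  \<comment> \<open>By idempotence \<open>i\<close> and \<open>pi_map R i\<close> lie in the same
    fiber of \<open>pi_map R\<close>.\<close>
  have absorb: "pi_map R' (pi_map R i) = pi_map R' i" if "i \<le> n" for i
    using K[rule_format, OF _ _ pi_map_idem[OF R that]] pi_map_bounds(2)[OF R that] that by simp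
  \<comment> \<open>Absorption forces inclusion:
    \<open>pi_map R x <= pi_map R' (pi_map R x) = pi_map R' x\<close>.\<close>
  have "R \<subseteq> R'"
  proof (rule subrelI)
    fix x y assume "(x, y) \<in> R"
    then have xy: "x \<le> n" "x \<le> y" "y \<le> pi_map R x"
      unfolding transfer_system_iff_pi_map[OF R] by auto
    have "pi_map R x \<le> pi_map R' x"
      using pi_map_bounds(1)[OF R' pi_map_bounds(2)[OF R xy(1)]] absorb[OF xy(1)] by simp
    then show "(x, y) \<in> R'" unfolding transfer_system_iff_pi_map[OF R'] using xy by simp
  qed
  then show ?C
    unfolding composition_closed_premodel_def using trans_if_pi_map_absorb[OF R R' absorb] by blast
qed

section \<open>Noncrossing partitions\<close>

text \<open>Indexing blocks by a point instead of a value of \<pi> builds in nonemptiness.\<close>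

lemma mem_fiber_partition_iff:
  assumes "transfer_system n R"
  shows "X \<in> fiber_partition n R \<longleftrightarrow>
    (\<exists>i\<le>n. X = {k \<in> {0..n}. pi_map R k = pi_map R i})"
proof
  assume "X \<in> fiber_partition n R"
  then obtain j where X: "X = {k \<in> {0..n}. pi_map R k = j}" "X \<noteq> {}"
    unfolding fiber_partition_def by auto
  then obtain i where "i \<le> n" "pi_map R i = j" by auto
  then show "\<exists>i\<le>n. X = {k \<in> {0..n}. pi_map R k = pi_map R i}"
    using X(1) by (intro exI[of _ i]) simp
next
  assume "\<exists>i\<le>n. X = {k \<in> {0..n}. pi_map R k = pi_map R i}"
  then obtain i where i: "i \<le> n" and X: "X = {k \<in> {0..n}. pi_map R k = pi_map R i}" by blast
  have "i \<in> X" using i X by simp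
  then show "X \<in> fiber_partition n R"
    unfolding fiber_partition_def using X pi_map_bounds(2)[OF assms i] by auto
qed

lemma fiber_mem_fiber_partition:
  assumes "transfer_system n R" "i \<le> n"
  shows "{k \<in> {0..n}. pi_map R k = pi_map R i} \<in> fiber_partition n R"
  unfolding mem_fiber_partition_iff[OF assms(1)] using assms(2) by (intro exI[of _ i]) simp

lemma partition_on_fiber_partition:
  assumes "transfer_system n R"
  shows "partition_on {0..n} (fiber_partition n R)"
proof (rule partition_onI)
  show "\<Union>(fiber_partition n R) = {0..n}"
  proof (intro equalityI subsetI)
    fix x assume "x \<in> {0..n}"
    then show "x \<in> \<Union>(fiber_partition n R)"
      using fiber_mem_fiber_partition[OF assms, of x] by (intro UnionI) auto
  qed (auto simp: fiber_partition_def)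
  show "disjnt X Y" if "X \<in> fiber_partition n R" "Y \<in> fiber_partition n R" "X \<noteq> Y" for X Y
    using that unfolding fiber_partition_def disjnt_def by auto
  show "{} \<notin> fiber_partition n R"
    unfolding fiber_partition_def by auto
qed

text \<open>For \<open>a < b < c < d\<close> with \<open>a\<close>, \<open>c\<close> in one fiber
  and \<open>b\<close>, \<open>d\<close> in one fiber, \<open>b\<close> lies below the common value
  of \<open>a\<close>, \<open>c\<close>, and \<open>c\<close> below that of \<open>b\<close>,
  \<open>d\<close>. Antimonotonicity then bounds each value by the other.\<close>

lemma noncrossing_fiber_partition:
  assumes R: "transfer_system n R"
  shows "noncrossing_partition n (fiber_partition n R)"
  unfolding noncrossing_partition_def
proof (intro conjI allI impI)
  fix a b c d
  assume H: "a < b \<and> b < c \<and> c < d \<and> (\<exists>X\<in>fiber_partition n R. {a, c} \<subseteq> X) \<and>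
    (\<exists>Y\<in>fiber_partition n R. {b, d} \<subseteq> Y)"
  then have ac: "pi_map R a = pi_map R c" "a \<le> n" "c \<le> n"
    and bd: "pi_map R b = pi_map R d" "b \<le> n" "d \<le> n"
    unfolding fiber_partition_def by auto
  have "pi_map R b \<le> pi_map R a"
    by (rule pi_map_antimono[OF R]) (use H ac pi_map_bounds(1)[OF R ac(3)] in auto)
  moreover have "pi_map R c \<le> pi_map R b"
    by (rule pi_map_antimono[OF R]) (use H bd pi_map_bounds(1)[OF R bd(3)] in auto)
  ultimately have "{a, b, c, d} \<subseteq> {k \<in> {0..n}. pi_map R k = pi_map R a}"
    using ac bd by auto
  then show "\<exists>Z\<in>fiber_partition n R. {a, b, c, d} \<subseteq> Z"
    using fiber_mem_fiber_partition[OF R ac(2)] by (rule bexI)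
qed (rule partition_on_fiber_partition[OF R])

lemma refines_fiber_partition_iff:
  assumes R: "transfer_system n R" and R': "transfer_system n R'"
  shows "refines {0..n} (fiber_partition n R) (fiber_partition n R') \<longleftrightarrow>
    (\<forall>i\<in>{0..n}. \<forall>j\<in>{0..n}. pi_map R i = pi_map R j \<longrightarrow> pi_map R' i = pi_map R' j)"
    (is "?L \<longleftrightarrow> ?K")
proof
  assume L: ?L
  show ?K
  proof (intro ballI impI)
    fix i j assume ij: "i \<in> {0..n}" "j \<in> {0..n}" "pi_map R i = pi_map R j"
    then have "{k \<in> {0..n}. pi_map R k = pi_map R i} \<in> fiber_partition n R"
      using fiber_mem_fiber_partition[OF R] by simp
    then obtain Y where Y: "Y \<in> fiber_partition n R'"
        and sub: "{k \<in> {0..n}. pi_map R k = pi_map R i} \<subseteq> Y"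
      using L unfolding refines_def by blast
    have "i \<in> Y" "j \<in> Y" using ij by (auto intro!: subsetD[OF sub])
    then show "pi_map R' i = pi_map R' j"
      using Y unfolding fiber_partition_def by auto
  qed
next
  assume K: ?K
  have "\<exists>Y\<in>fiber_partition n R'. X \<subseteq> Y" if X: "X \<in> fiber_partition n R" for X
  proof -
    obtain i where i: "i \<le> n" "X = {k \<in> {0..n}. pi_map R k = pi_map R i}"
      using X mem_fiber_partition_iff[OF R] by blast
    have "X \<subseteq> {k \<in> {0..n}. pi_map R' k = pi_map R' i}"
    proof
      fix k assume "k \<in> X"
      then show "k \<in> {k \<in> {0..n}. pi_map R' k = pi_map R' i}"
        using K[rule_format, of k i] i by simp
    qed
    then show ?thesis using fiber_mem_fiber_partition[OF R' i(1)] by (rule bexI)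
  qed
  then show ?L
    unfolding refines_def using partition_on_fiber_partition[OF R] partition_on_fiber_partition[OF R']
    by blast
qed

lemma kreweras_le_fiber_partition_iff:
  assumes R: "transfer_system n R" and R': "transfer_system n R'"
  shows "kreweras_le n (fiber_partition n R) (fiber_partition n R') \<longleftrightarrow>
    (\<forall>i\<in>{0..n}. \<forall>j\<in>{0..n}. pi_map R i = pi_map R j \<longrightarrow> pi_map R' i = pi_map R' j)"
  unfolding kreweras_le_def refines_fiber_partition_iff[OF assms]
  using noncrossing_fiber_partition[OF R] noncrossing_fiber_partition[OF R'] by blast

section \<open>The bijection between transfer systems and noncrossing partitions\<close>

lemma pi_map_eq_Max_block:
  assumes R: "transfer_system n R" and X: "X \<in> fiber_partition n R" "i \<in> X"
  shows "pi_map R i = Max X"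
proof -
  have X_eq: "X = {k \<in> {0..n}. pi_map R k = pi_map R i}" and i: "i \<le> n"
    using X unfolding fiber_partition_def by auto
  show ?thesis
  proof (rule Max_eqI[symmetric])
    show "finite X" unfolding X_eq by simp
    show "k \<le> pi_map R i" if "k \<in> X" for k
      using that pi_map_bounds(1)[OF R, of k] unfolding X_eq by auto
    show "pi_map R i \<in> X"
      unfolding X_eq using pi_map_idem[OF R i] pi_map_bounds(2)[OF R i] by simp
  qed
qed

text \<open>The maxima of the blocks recover \<pi>, and \<pi> recovers the relation.\<close>

lemma inj_on_fiber_partition: "inj_on (fiber_partition n) {R. transfer_system n R}"
proof (rule inj_onI)
  fix R S assume "R \<in> {R. transfer_system n R}" "S \<in> {R. transfer_system n R}"
    and eq: "fiber_partition n R = fiber_partition n S"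
  then have R: "transfer_system n R" and S: "transfer_system n S" by auto
  have "pi_map R i = pi_map S i" if "i \<le> n" for i
  proof -
    define X where "X = {k \<in> {0..n}. pi_map R k = pi_map R i}"
    have X: "X \<in> fiber_partition n R" "i \<in> X"
      using fiber_mem_fiber_partition[OF R that] that by (simp_all add: X_def)
    show ?thesis
      using pi_map_eq_Max_block[OF R X] pi_map_eq_Max_block[OF S X[unfolded eq]] by simp
  qed
  then show "R = S"
    by (auto simp: set_eq_iff transfer_system_iff_pi_map[OF R] transfer_system_iff_pi_map[OF S])
qed

lemma fiber_partition_surj:
  assumes P: "noncrossing_partition n P"
  shows "\<exists>R. transfer_system n R \<and> fiber_partition n R = P"
proof -
  have part: "partition_on {0..n} P" using P unfolding noncrossing_partition_def by blast
  have fin: "finite X" if "X \<in> P" for X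
    by (rule finite_subset[of _ "{0..n}"]) (use part that in \<open>auto simp: partition_on_def\<close>)
  have Max_mem: "Max X \<in> X" if "X \<in> P" for X
    using Max_in[OF fin[OF that]] part that unfolding partition_on_def by auto
  have block_le: "x \<le> n" if "X \<in> P" "x \<in> X" for X x
    using part that unfolding partition_on_def by auto
  have uniq: "X = Y" if "X \<in> P" "Y \<in> P" "x \<in> X" "x \<in> Y" for X Y x
    using part that unfolding partition_on_def disjoint_def by blast
  have cover: "\<exists>X\<in>P. x \<in> X" if "x \<le> n" for x
  proof -
    have "x \<in> \<Union>P" using partition_onD1[OF part] that by auto
    then show ?thesis by blast
  qed
  \<comment> \<open>This is antimonotonicity for the map sending a point to the maximum of its
    block. A failure would make \<open>x < y < Max X < Max Y\<close> a crossing of two distinct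
    blocks.\<close>
  have Max_le: "Max Y \<le> Max X"
    if X: "X \<in> P" "x \<in> X" and Y: "Y \<in> P" "y \<in> Y" and xy: "x \<le> y" "y \<le> Max X" for X Y x y
  proof (rule ccontr)
    assume less: "\<not> Max Y \<le> Max X"
    then have "X \<noteq> Y" by auto
    then have "x \<noteq> y" "y \<noteq> Max X" using uniq X Y Max_mem by blast+
    then have "x < y \<and> y < Max X \<and> Max X < Max Y" using xy less by simp
    moreover have "\<exists>Z\<in>P. {x, Max X} \<subseteq> Z" "\<exists>Z\<in>P. {y, Max Y} \<subseteq> Z"
      using X Y Max_mem by auto
    ultimately obtain Z where "Z \<in> P" "{x, y, Max X, Max Y} \<subseteq> Z"
      using P unfolding noncrossing_partition_def by meson
    then have "Z = X" "Z = Y" using uniq X Y by auto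
    then show False using \<open>X \<noteq> Y\<close> by simp
  qed
  \<comment> \<open>The formula is forced: \<pi> must send each point to the maximum of its block,
    and \<pi> determines the relation.\<close>
  define R where "R = {(x, y). \<exists>X\<in>P. x \<in> X \<and> x \<le> y \<and> y \<le> Max X}"
  have R_sub: "R \<subseteq> {0..n} \<times> {0..n}"
  proof (rule subrelI)
    fix x y assume "(x, y) \<in> R"
    then obtain X where X: "X \<in> P" "x \<in> X" "y \<le> Max X" unfolding R_def by blast
    then show "(x, y) \<in> {0..n} \<times> {0..n}"
      using block_le[OF X(1,2)] block_le[OF X(1) Max_mem[OF X(1)]] by simp
  qed
  have R_trans: "trans R"
  proof (rule transI)
    fix x y z assume "(x, y) \<in> R" "(y, z) \<in> R"
    then obtain X Y where X: "X \<in> P" "x \<in> X" "x \<le> y" "y \<le> Max X"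
        and Y: "Y \<in> P" "y \<in> Y" "y \<le> z" "z \<le> Max Y"
      unfolding R_def by blast
    then have "x \<le> z" "z \<le> Max X"
      using Max_le[OF X(1,2) Y(1,2) X(3,4)] by simp_all
    then show "(x, z) \<in> R" unfolding R_def using X(1,2) by blast
  qed
  have R_refl: "refl_on {0..n} R"
  proof (rule refl_onI)
    fix x assume "x \<in> {0..n}"
    then obtain X where X: "X \<in> P" "x \<in> X" using cover by auto
    then show "(x, x) \<in> R" unfolding R_def using Max_ge[OF fin[OF X(1)] X(2)] by blast
  qed
  have R_antisym: "antisym R"
    unfolding R_def by (rule antisymI) auto
  \<comment> \<open>For \<open>x <= z\<close> the target moves down within the same interval; for
    \<open>z < x\<close> the pair is an identity.\<close>
  have R_restrict: "(min x z, z) \<in> R" if xy: "(x, y) \<in> R" and zy: "z \<le> y" for x y z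
  proof (cases "x \<le> z")
    case True
    then show ?thesis using xy zy unfolding R_def by (auto simp: min_def)
  next
    case False
    have "z \<le> n" using xy zy R_sub by auto
    then show ?thesis using False R_refl by (simp add: min_def refl_on_def)
  qed
  have R_le: "x \<le> y" if "(x, y) \<in> R" for x y
    using that unfolding R_def by blast
  have ts: "transfer_system n R"
    unfolding transfer_system_def partial_order_on_def preorder_on_def
    using R_sub R_trans R_refl R_antisym R_le R_restrict by blast
  have pi: "pi_map R x = Max X" if X: "X \<in> P" "x \<in> X" for X x
  proof -
    have "{j. (x, j) \<in> R} = {x..Max X}"
    proof (intro set_eqI iffI)
      fix j assume "j \<in> {j. (x, j) \<in> R}"
      then obtain Y where Y: "Y \<in> P" "x \<in> Y" "x \<le> j" "j \<le> Max Y"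
        unfolding R_def by blast
      then show "j \<in> {x..Max X}" using uniq[OF X(1) Y(1) X(2) Y(2)] by simp
    qed (use X in \<open>auto simp: R_def\<close>)
    then show ?thesis
      unfolding pi_map_def using Max_ge[OF fin[OF X(1)] X(2)] by (auto intro: Max_eqI)
  qed
  have fiber: "{k \<in> {0..n}. pi_map R k = pi_map R x} = X" if X: "X \<in> P" "x \<in> X" for X x
  proof (intro set_eqI iffI)
    fix k assume k: "k \<in> {k \<in> {0..n}. pi_map R k = pi_map R x}"
    then obtain Y where Y: "Y \<in> P" "k \<in> Y" using cover by auto
    then have "Max Y = Max X" using k pi X by simp
    \<comment> \<open>Blocks with equal maxima share that point, hence coincide.\<close>
    then have "Y = X" using uniq[OF Y(1) X(1) Max_mem[OF Y(1)]] Max_mem[OF X(1)] by simp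
    then show "k \<in> X" using Y by simp
  next
    fix k assume k: "k \<in> X"
    show "k \<in> {k \<in> {0..n}. pi_map R k = pi_map R x}"
      using pi[OF X] pi[OF X(1) k] block_le[OF X(1) k] by simp
  qed
  have "fiber_partition n R = P"
  proof (intro set_eqI iffI)
    fix X assume "X \<in> fiber_partition n R"
    then obtain i where i: "i \<le> n" "X = {k \<in> {0..n}. pi_map R k = pi_map R i}"
      using mem_fiber_partition_iff[OF ts] by blast
    then obtain Y where Y: "Y \<in> P" "i \<in> Y" using cover by blast
    show "X \<in> P" using fiber[OF Y] Y(1) i(2) by simp
  next
    fix X assume X: "X \<in> P"
    show "X \<in> fiber_partition n R"
      using fiber_mem_fiber_partition[OF ts block_le[OF X Max_mem[OF X]]]
      unfolding fiber[OF X Max_mem[OF X]] .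
  qed
  then show ?thesis using ts by blast
qed

lemma bij_betw_fiber_partition:
  "bij_betw (fiber_partition n) {R. transfer_system n R} {P. noncrossing_partition n P}"
  unfolding bij_betw_def
  using inj_on_fiber_partition noncrossing_fiber_partition fiber_partition_surj by blast

theorem theorem4p6:
  fixes n :: nat
  shows
    "(\<forall>R R'. transfer_system n R \<and> transfer_system n R' \<and> R \<subseteq> R' \<longrightarrow>
        (composition_closed_premodel n R R' \<longleftrightarrow>
           kreweras_le n (fiber_partition n R) (fiber_partition n R')) \<and>
        (composition_closed_premodel n R R' \<longleftrightarrow>
           (\<forall>i\<in>{0..n}. \<forall>j\<in>{0..n}. pi_map R i = pi_map R j \<longrightarrow> pi_map R' i = pi_map R' j))) \<and>
     bij_betw (fiber_partition n) {R. transfer_system n R} {P. noncrossing_partition n P} \<and>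
     (\<forall>R R'. transfer_system n R \<and> transfer_system n R' \<longrightarrow>
        (composition_closed_premodel n R R' \<longleftrightarrow>
           kreweras_le n (fiber_partition n R) (fiber_partition n R')))"
  \<comment> \<open>Premodel condition and Kreweras order both rewrite to the same pointwise
    condition on the two maps.\<close>
  by (intro conjI allI impI bij_betw_fiber_partition)
    (simp_all only: composition_closed_premodel_iff_pi_map kreweras_le_fiber_partition_iff)

end
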